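(* Let $E,E_0\in\mathcal G$ be Banach spaces with scaling exponents $\sigma_E,\sigma_{E_0}$ satisfying $\sigma_{E_0}-\sigma_E-1=0$. Assume that $\nabla U(t):E\to E_0$ is a bounded operator (for every $t>0$) and that there is a constant $C>0$ with $$\int_0^\infty s^{\frac12(\sigma_{E_0}-\sigma_E)-\frac12}\,\|\nabla U(s)h\|_{E_0}\,ds\le C\|h\|_E\qquad\text{for all }h\in E.$$ Given $f\in L^\infty((0,\infty);E_0')$, define the linear functional $\mathcal T(f)\in E'$ by $$\langle \mathcal T(f),h\rangle=-\int_0^\infty\langle \nabla U(s)f(s),h\rangle\,ds\qquad\text{for all }h\in E.$$ Then there exists a constant $C>0$ such that $$\|\mathcal T(f)\|_{E'}\le C\sup_{t>0}\|f(t)\|_{E_0'}$$ for all $f\in L^\infty((0,\infty);E_0')$.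
   Context: All spaces are over $\mathbb R^n$, $n\ge 3$. For $f\in\mathcal S'$ and $\lambda>0$, $f_\lambda=f(\lambda\,\cdot)$. $\mathcal G$ is the class of all Banach spaces $F\subset\mathcal S'$ for which there exist $\sigma_F\in\mathbb R$ and $C>0$ such that $f_\lambda\in F$ and $\|f_\lambda\|_F\le C\lambda^{\sigma_F}\|f\|_F$ for all $\lambda>0$, $f\in F$. $E'$ denotes the dual of a Banach space $E$. $\Phi(t,x)=(4\pi t)^{-n/2}e^{-|x|^2/(4t)}$ is the heat kernel, $U(t)f=\Phi(t,\cdot)*f$ and $\nabla U(t)f=(\nabla\Phi(t,\cdot))*f$. On $E_0'$ the operator $\nabla U(s):E_0'\to E'$ is understood by duality: $\langle\nabla U(s)g,h\rangle=-\langle g,\nabla U(s)h\rangle$ for $g\in E_0'$, $h\in E$. *)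

theory Defs
  imports "HOL-Probability.Probability" "HOL-Library.Function_Algebras"
begin

text \<open>
  The scalar field is a type \<open>'k\<close> of classes \<open>real_normed_field\<close> and \<open>euclidean_space\<close>.  Up to
  isomorphism these are \<open>real\<close> and \<open>complex\<close>, so real- and complex-valued distributions are covered
  simultaneously.  A distribution is a functional on all functions, normalised to vanish outside
  the Schwartz space so that equality of distributions is equality of functionals.  Addition,
  subtraction and \<open>0\<close> of functions are pointwise (from \<open>Function_Algebras\<close>).
\<close>

type_synonym ('k, 'n) distr = "(real ^ 'n \<Rightarrow> 'k) \<Rightarrow> 'k"

section \<open>Schwartz functions and tempered distributions\<close>

definition pderiv_dir :: "'n::finite \<Rightarrow> (real ^ 'n \<Rightarrow> 'b::real_normed_vector) \<Rightarrow> real ^ 'n \<Rightarrow> 'b" where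
  "pderiv_dir j \<phi> = (\<lambda>x. frechet_derivative \<phi> (at x) (axis j 1))"

text \<open>A multi-index is a list of directions; \<open>pderivs [i, j] \<phi>\<close> is \<open>\<partial>\<^sub>i \<partial>\<^sub>j \<phi>\<close>.\<close>

definition pderivs :: "'n::finite list \<Rightarrow> (real ^ 'n \<Rightarrow> 'b::real_normed_vector) \<Rightarrow> real ^ 'n \<Rightarrow> 'b" where
  "pderivs is \<phi> = foldr pderiv_dir is \<phi>"

definition smooth :: "(real ^ 'n::finite \<Rightarrow> 'b::real_normed_vector) \<Rightarrow> bool" where
  "smooth \<phi> \<longleftrightarrow> (\<forall>is x. pderivs is \<phi> differentiable (at x))"

definition schwartz :: "(real ^ 'n::finite \<Rightarrow> 'b::real_normed_vector) set" where
  "schwartz = {\<phi>. smooth \<phi> \<and>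
     (\<forall>k is. bdd_above (range (\<lambda>x. (1 + norm x) ^ k * norm (pderivs is \<phi> x))))}"

definition schwartz_seminorm :: "nat \<Rightarrow> 'n::finite list \<Rightarrow> (real ^ 'n \<Rightarrow> 'b::real_normed_vector) \<Rightarrow> real" where
  "schwartz_seminorm k is \<phi> = (SUP x. (1 + norm x) ^ k * norm (pderivs is \<phi> x))"

text \<open>Continuity on the Schwartz space, expressed by its defining family of seminorms.\<close>

definition tempered :: "('k::{real_normed_field, euclidean_space}, 'n::finite) distr set" where
  "tempered = {u.
     (\<forall>\<phi>. \<phi> \<notin> schwartz \<longrightarrow> u \<phi> = 0) \<and>
     (\<forall>\<phi>\<in>schwartz. \<forall>\<psi>\<in>schwartz. u (\<phi> + \<psi>) = u \<phi> + u \<psi>) \<and>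
     (\<forall>c. \<forall>\<phi>\<in>schwartz. u (\<lambda>x. c * \<phi> x) = c * u \<phi>) \<and>
     (\<exists>C k m. \<forall>\<phi>\<in>schwartz.
        norm (u \<phi>) \<le> C * (\<Sum>is | length is \<le> m. schwartz_seminorm k is \<phi>))}"

definition smul :: "'k::times \<Rightarrow> ('a \<Rightarrow> 'k) \<Rightarrow> 'a \<Rightarrow> 'k" where
  "smul c u = (\<lambda>a. c * u a)"

text \<open>
  The dilation \<open>f\<^sub>\<lambda> = f (\<lambda> \<cdot>)\<close>, extended from functions to distributions by the change of variables
  \<open>\<integral> f (\<lambda> x) \<phi> x dx = \<lambda> ^ (- n) \<integral> f y \<phi> (y / \<lambda>) dy\<close>.
\<close>

definition dilate :: "real \<Rightarrow> ('k::{real_normed_field, euclidean_space}, 'n::finite) distr \<Rightarrow> ('k, 'n) distr" where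
  "dilate r u = (\<lambda>\<phi>. (1 / r ^ CARD('n)) *\<^sub>R u (\<lambda>x. \<phi> ((1 / r) *\<^sub>R x)))"

section \<open>Heat kernel\<close>

definition heat_kernel :: "real \<Rightarrow> real ^ 'n::finite \<Rightarrow> real" where
  "heat_kernel t x = (4 * pi * t) powr (- (real CARD('n) / 2)) * exp (- (norm x)\<^sup>2 / (4 * t))"

definition conv :: "(real ^ 'n::finite \<Rightarrow> real) \<Rightarrow> (real ^ 'n \<Rightarrow> 'k::{real_normed_field, euclidean_space}) \<Rightarrow> real ^ 'n \<Rightarrow> 'k" where
  "conv \<psi> \<phi> = (\<lambda>x. LINT y|lborel. \<psi> (x - y) *\<^sub>R \<phi> y)"

text \<open>
  \<open>\<psi> * u\<close> for a Schwartz function \<open>\<psi>\<close> and a tempered distribution \<open>u\<close>, given by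
  \<open>\<langle>\<psi> * u, \<phi>\<rangle> = \<langle>u, \<psi>(- \<cdot>) * \<phi>\<rangle>\<close>.
\<close>

definition conv_distr :: "(real ^ 'n::finite \<Rightarrow> real) \<Rightarrow> ('k::{real_normed_field, euclidean_space}, 'n) distr \<Rightarrow> ('k, 'n) distr" where
  "conv_distr \<psi> u = (\<lambda>\<phi>. if \<phi> \<in> schwartz then u (conv (\<lambda>x. \<psi> (- x)) \<phi>) else 0)"

definition grad_heat :: "real \<Rightarrow> ('k::{real_normed_field, euclidean_space}, 'n::finite) distr \<Rightarrow> ('k, 'n) distr ^ 'n" where
  "grad_heat t u = (\<chi> j. conv_distr (pderiv_dir j (heat_kernel t)) u)"

section \<open>Banach spaces of tempered distributions\<close>

definition banach_in_tempered :: "('k::{real_normed_field, euclidean_space}, 'n::finite) distr set \<Rightarrow> (('k, 'n) distr \<Rightarrow> real) \<Rightarrow> bool" where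
  "banach_in_tempered F N \<longleftrightarrow>
     F \<subseteq> tempered \<and> 0 \<in> F \<and>
     (\<forall>u\<in>F. \<forall>v\<in>F. u + v \<in> F) \<and> (\<forall>c. \<forall>u\<in>F. smul c u \<in> F) \<and>
     (\<forall>u\<in>F. N u = 0 \<longleftrightarrow> u = 0) \<and>
     (\<forall>u\<in>F. \<forall>v\<in>F. N (u + v) \<le> N u + N v) \<and>
     (\<forall>c. \<forall>u\<in>F. N (smul c u) = norm c * N u) \<and>
     (\<forall>X :: nat \<Rightarrow> ('k, 'n) distr. (\<forall>i. X i \<in> F) \<longrightarrow>
        (\<forall>e>0. \<exists>m. \<forall>i\<ge>m. \<forall>j\<ge>m. N (X i - X j) < e) \<longrightarrow>
        (\<exists>u\<in>F. (\<lambda>i. N (X i - u)) \<longlonglongrightarrow> 0))"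

text \<open>Membership in the class \<open>\<G>\<close> with scaling exponent \<open>\<sigma>\<close>.\<close>

definition class_G :: "('k::{real_normed_field, euclidean_space}, 'n::finite) distr set \<Rightarrow> (('k, 'n) distr \<Rightarrow> real) \<Rightarrow> real \<Rightarrow> bool" where
  "class_G F N \<sigma> \<longleftrightarrow> banach_in_tempered F N \<and>
     (\<exists>C>0. \<forall>r>0. \<forall>u\<in>F. dilate r u \<in> F \<and> N (dilate r u) \<le> C * r powr \<sigma> * N u)"

definition dual :: "('k::{real_normed_field, euclidean_space}, 'n::finite) distr set \<Rightarrow> (('k, 'n) distr \<Rightarrow> real) \<Rightarrow> (('k, 'n) distr \<Rightarrow> 'k) set" where
  "dual F N = {l.
     (\<forall>u. u \<notin> F \<longrightarrow> l u = 0) \<and>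
     (\<forall>u\<in>F. \<forall>v\<in>F. l (u + v) = l u + l v) \<and>
     (\<forall>c. \<forall>u\<in>F. l (smul c u) = c * l u) \<and>
     (\<exists>C. \<forall>u\<in>F. norm (l u) \<le> C * N u)}"

definition dual_norm :: "('k::{real_normed_field, euclidean_space}, 'n::finite) distr set \<Rightarrow> (('k, 'n) distr \<Rightarrow> real) \<Rightarrow> (('k, 'n) distr \<Rightarrow> 'k) \<Rightarrow> real" where
  "dual_norm F N l = (SUP u\<in>{u \<in> F. N u \<le> 1}. norm (l u))"

text \<open>
  Since \<open>\<nabla> U(t) h\<close> is a vector field, \<open>F\<close>-valued statements about it are meant componentwise: vector
  fields with components in \<open>F\<close> carry the Euclidean norm of the component norms, and the dual of
  that space is the space of \<open>n\<close>-tuples in \<open>F'\<close>, paired by \<open>\<langle>g, v\<rangle> = \<Sum>\<^sub>j \<langle>g\<^sub>j, v\<^sub>j\<rangle>\<close>; the Euclidean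
  norm of the dual norms below is the corresponding dual norm.
\<close>

definition vec_space :: "('k, 'n::finite) distr set \<Rightarrow> (('k, 'n) distr ^ 'n) set" where
  "vec_space F = {v. \<forall>j. v $ j \<in> F}"

definition vec_norm :: "(('k, 'n::finite) distr \<Rightarrow> real) \<Rightarrow> ('k, 'n) distr ^ 'n \<Rightarrow> real" where
  "vec_norm N v = L2_set (\<lambda>j. N (v $ j)) UNIV"

definition vec_dual :: "('k::{real_normed_field, euclidean_space}, 'n::finite) distr set \<Rightarrow> (('k, 'n) distr \<Rightarrow> real) \<Rightarrow> ((('k, 'n) distr \<Rightarrow> 'k) ^ 'n) set" where
  "vec_dual F N = {g. \<forall>j. g $ j \<in> dual F N}"

definition vec_dual_norm :: "('k::{real_normed_field, euclidean_space}, 'n::finite) distr set \<Rightarrow> (('k, 'n) distr \<Rightarrow> real) \<Rightarrow> (('k, 'n) distr \<Rightarrow> 'k) ^ 'n \<Rightarrow> real" where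
  "vec_dual_norm F N g = L2_set (\<lambda>j. dual_norm F N (g $ j)) UNIV"

definition pairing :: "(('k::{real_normed_field, euclidean_space}, 'n::finite) distr \<Rightarrow> 'k) ^ 'n \<Rightarrow> ('k, 'n) distr ^ 'n \<Rightarrow> 'k" where
  "pairing g v = (\<Sum>j\<in>UNIV. (g $ j) (v $ j))"

text \<open>\<open>\<nabla> U(s)\<close> on the dual of \<open>E\<^sub>0\<close>, with values in the dual of \<open>E\<close>.\<close>

definition grad_heat_dual :: "('k::{real_normed_field, euclidean_space}, 'n::finite) distr set \<Rightarrow> real \<Rightarrow> (('k, 'n) distr \<Rightarrow> 'k) ^ 'n \<Rightarrow> ('k, 'n) distr \<Rightarrow> 'k" where
  "grad_heat_dual E s g = (\<lambda>h. if h \<in> E then - pairing g (grad_heat s h) else 0)"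

section \<open>The Bochner space of essentially bounded functions and the functional \<open>\<T>\<close>\<close>

abbreviation half_line :: "real measure" where
  "half_line \<equiv> lebesgue_on {0<..}"

text \<open>
  Strong measurability: almost everywhere limit, in the norm of the dual, of simple functions.
\<close>

definition strongly_measurable :: "('k::{real_normed_field, euclidean_space}, 'n::finite) distr set \<Rightarrow> (('k, 'n) distr \<Rightarrow> real) \<Rightarrow> (real \<Rightarrow> (('k, 'n) distr \<Rightarrow> 'k) ^ 'n) \<Rightarrow> bool" where
  "strongly_measurable F N f \<longleftrightarrow>
     (\<exists>S :: nat \<Rightarrow> real \<Rightarrow> (('k, 'n) distr \<Rightarrow> 'k) ^ 'n.
        (\<forall>i. simple_function half_line (S i) \<and> (\<forall>s>0. S i s \<in> vec_dual F N)) \<and>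
        (AE s in half_line. (\<lambda>i. vec_dual_norm F N (S i s - f s)) \<longlonglongrightarrow> 0))"

definition Linf_norm :: "('k::{real_normed_field, euclidean_space}, 'n::finite) distr set \<Rightarrow> (('k, 'n) distr \<Rightarrow> real) \<Rightarrow> (real \<Rightarrow> (('k, 'n) distr \<Rightarrow> 'k) ^ 'n) \<Rightarrow> ereal" where
  "Linf_norm F N f = esssup half_line (\<lambda>s. ereal (vec_dual_norm F N (f s)))"

definition Linf_dual :: "('k::{real_normed_field, euclidean_space}, 'n::finite) distr set \<Rightarrow> (('k, 'n) distr \<Rightarrow> real) \<Rightarrow> (real \<Rightarrow> (('k, 'n) distr \<Rightarrow> 'k) ^ 'n) set" where
  "Linf_dual F N = {f. (\<forall>s>0. f s \<in> vec_dual F N) \<and> strongly_measurable F N f \<and> Linf_norm F N f < \<infinity>}"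

definition T_op :: "('k::{real_normed_field, euclidean_space}, 'n::finite) distr set \<Rightarrow> (real \<Rightarrow> (('k, 'n) distr \<Rightarrow> 'k) ^ 'n) \<Rightarrow> ('k, 'n) distr \<Rightarrow> 'k" where
  "T_op E f = (\<lambda>h. if h \<in> E then - (LINT s|half_line. grad_heat_dual E s (f s) h) else 0)"

end

theory Submission
  imports Defs
begin

text \<open>
  Since \<open>\<sigma>\<^sub>E\<^sub>0 - \<sigma>\<^sub>E = 1\<close>, the weight in the integral hypothesis is identically 1.  Pointwise in \<open>s\<close>,
  duality and Cauchy--Schwarz give \<open>|\<langle>\<nabla>U(s) f(s), h\<rangle>| \<le> \<parallel>f(s)\<parallel> \<parallel>\<nabla>U(s) h\<parallel>\<close>, so the integrand
  is dominated by the essential supremum of \<open>\<parallel>f\<parallel>\<close> times an integrable function.  Its measurability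
  comes from approximating \<open>f\<close> by simple functions, for which weak measurability applies.
\<close>

section \<open>Normed spaces of distributions and their duals\<close>

lemma smul_zero_left: "smul (0::'k::mult_zero) u = 0"
  by (simp add: smul_def fun_eq_iff)

lemma smul_minus_one: "smul (- 1 :: 'k::ring_1) u = - u"
  by (simp add: smul_def fun_eq_iff)

context
  fixes F :: "('k::{real_normed_field, euclidean_space}, 'n::finite) distr set" and N
  assumes F: "banach_in_tempered F N"
begin

lemma zero_mem: "0 \<in> F" and norm_zero_distr: "N 0 = 0"
  using F by (auto simp: banach_in_tempered_def)

lemma add_mem: "u \<in> F \<Longrightarrow> v \<in> F \<Longrightarrow> u + v \<in> F"
  using F by (auto simp: banach_in_tempered_def)

lemma smul_mem: "u \<in> F \<Longrightarrow> smul c u \<in> F" and norm_smul: "u \<in> F \<Longrightarrow> N (smul c u) = norm c * N u"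
  using F by (auto simp: banach_in_tempered_def)

lemma norm_add_le: "u \<in> F \<Longrightarrow> v \<in> F \<Longrightarrow> N (u + v) \<le> N u + N v"
  using F by (auto simp: banach_in_tempered_def)

lemma norm_eq_zeroD: "u \<in> F \<Longrightarrow> N u = 0 \<Longrightarrow> u = 0"
  using F by (auto simp: banach_in_tempered_def)

text \<open>Nonnegativity is not among the axioms on \<open>N\<close>; the triangle inequality for
  \<open>u\<close> and \<open>- u\<close> yields \<open>0 \<le> 2 * N u\<close>.\<close>

lemma norm_distr_nonneg:
  assumes u: "u \<in> F"
  shows "0 \<le> N u"
proof -
  have "N (u + smul (- 1) u) \<le> N u + N (smul (- 1) u)"
    by (intro norm_add_le smul_mem u)
  then show ?thesis
    using norm_smul[OF u, of "- 1"] norm_zero_distr by (simp add: smul_minus_one)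
qed

section \<open>Continuous functionals and their dual norm\<close>

lemma dual_zero:
  assumes "l \<in> dual F N"
  shows "l 0 = 0"
proof -
  have "l (smul 0 0) = 0 * l 0"
    using assms zero_mem unfolding dual_def by blast
  then show ?thesis by (simp add: smul_zero_left)
qed

text \<open>Gives meaning to \<open>dual_norm\<close>, since a real \<open>SUP\<close> is
  informative only over a bounded set.\<close>

lemma bdd_above_dual:
  assumes "l \<in> dual F N"
  shows "bdd_above ((\<lambda>u. norm (l u)) ` {u \<in> F. N u \<le> 1})"
proof -
  obtain C where C: "\<And>u. u \<in> F \<Longrightarrow> norm (l u) \<le> C * N u"
    using assms unfolding dual_def by blast
  have "norm (l u) \<le> \<bar>C\<bar>" if "u \<in> F" "N u \<le> 1" for u
  proof -
    \<comment> \<open>The constant may be negative, hence the absolute value.\<close>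
    have "C * N u \<le> \<bar>C\<bar> * 1"
      using norm_distr_nonneg[OF that(1)] that(2) by (intro mult_mono) auto
    with C[OF that(1)] show ?thesis by simp
  qed
  then show ?thesis by (auto intro!: bdd_aboveI2)
qed

lemma dual_norm_nonneg:
  assumes "l \<in> dual F N"
  shows "0 \<le> dual_norm F N l"
proof -
  have "norm (l 0) \<le> dual_norm F N l"
    unfolding dual_norm_def
    by (rule cSUP_upper[OF _ bdd_above_dual[OF assms]]) (simp add: zero_mem norm_zero_distr)
  then show ?thesis
    by (rule order_trans[OF norm_ge_zero])
qed

text \<open>Rescaling \<open>u\<close> to norm one puts it in the unit ball of the supremum, and
  homogeneity undoes the scaling. A vector of norm zero cannot be rescaled, but is itself
  zero.\<close>

lemma dual_norm_bound:
  assumes l: "l \<in> dual F N" and u: "u \<in> F"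
  shows "norm (l u) \<le> dual_norm F N l * N u"
proof (cases "N u = 0")
  case True
  then show ?thesis using norm_eq_zeroD[OF u] dual_zero[OF l] by auto
next
  case False
  then have pos: "0 < N u" using norm_distr_nonneg[OF u] by simp
  let ?c = "of_real (1 / N u) :: 'k"
  have "norm (l (smul ?c u)) \<le> dual_norm F N l"
    unfolding dual_norm_def
    by (rule cSUP_upper[OF _ bdd_above_dual[OF l]])
      (use pos in \<open>simp add: smul_mem[OF u] norm_smul[OF u] norm_divide\<close>)
  moreover have "l (smul ?c u) = ?c * l u"
    using l u unfolding dual_def by blast
  ultimately have "norm (l u) / N u \<le> dual_norm F N l"
    using pos by (simp add: norm_mult norm_divide)
  with pos show ?thesis
    by (simp add: divide_le_eq)
qed

text \<open>Lets the pairing estimate be applied to approximation errors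
  \<open>S i - g\<close>.\<close>

lemma dual_diff:
  assumes l: "l \<in> dual F N" and m: "m \<in> dual F N"
  shows "l - m \<in> dual F N"
proof -
  obtain A where "\<And>u. u \<in> F \<Longrightarrow> norm (l u) \<le> A * N u"
    using l unfolding dual_def by blast
  moreover obtain B where "\<And>u. u \<in> F \<Longrightarrow> norm (m u) \<le> B * N u"
    using m unfolding dual_def by blast
  ultimately have "norm (l u - m u) \<le> (A + B) * N u" if "u \<in> F" for u
    using norm_triangle_ineq4[of "l u" "m u"] that by (fastforce simp: distrib_right)
  then have "\<exists>K. \<forall>u\<in>F. norm (l u - m u) \<le> K * N u"
    by blast
  then show ?thesis
    using l m unfolding dual_def by (simp add: right_diff_distrib)
qed

text \<open>The dual norm controls each component; Cauchy-Schwarz then combines the products of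
  component norms.\<close>

lemma norm_pairing_le:
  assumes g: "g \<in> vec_dual F N" and v: "v \<in> vec_space F"
  shows "norm (pairing g v) \<le> vec_dual_norm F N g * vec_norm N v"
proof -
  have g: "g $ j \<in> dual F N" and v: "v $ j \<in> F" for j
    using assms by (auto simp: vec_dual_def vec_space_def)
  have "norm (pairing g v) \<le> (\<Sum>j\<in>UNIV. norm ((g $ j) (v $ j)))"
    unfolding pairing_def by (rule norm_sum)
  also have "\<dots> \<le> (\<Sum>j\<in>UNIV. \<bar>dual_norm F N (g $ j)\<bar> * \<bar>N (v $ j)\<bar>)"
    using dual_norm_bound[OF g v] dual_norm_nonneg[OF g] norm_distr_nonneg[OF v]
    by (intro sum_mono) simp
  also have "\<dots> \<le> vec_dual_norm F N g * vec_norm N v"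
    unfolding vec_dual_norm_def vec_norm_def by (rule L2_set_mult_ineq)
  finally show ?thesis .
qed

lemma pairing_add_right:
  assumes "g \<in> vec_dual F N" "v \<in> vec_space F" "w \<in> vec_space F"
  shows "pairing g (v + w) = pairing g v + pairing g w"
  using assms by (simp add: pairing_def vec_dual_def vec_space_def dual_def sum.distrib)

lemma pairing_smul_right:
  assumes "g \<in> vec_dual F N" "v \<in> vec_space F"
  shows "pairing g (\<chi> j. smul c (v $ j)) = c * pairing g v"
  using assms by (simp add: pairing_def vec_dual_def vec_space_def dual_def sum_distrib_left)

lemma tendsto_pairing:
  assumes S: "\<And>i. S i \<in> vec_dual F N" and g: "g \<in> vec_dual F N" and v: "v \<in> vec_space F"
    and lim: "(\<lambda>i. vec_dual_norm F N (S i - g)) \<longlonglongrightarrow> 0"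
  shows "(\<lambda>i. pairing (S i) v) \<longlonglongrightarrow> pairing g v"
proof (rule Lim_transform_bound[where f = "\<lambda>i. pairing (S i) v - pairing g v", THEN LIM_zero_cancel])
  have "S i - g \<in> vec_dual F N" for i
    using S[of i] g dual_diff by (simp add: vec_dual_def)
  then have "norm (pairing (S i - g) v) \<le> vec_dual_norm F N (S i - g) * vec_norm N v" for i
    using v by (rule norm_pairing_le)
  moreover have "pairing (S i - g) v = pairing (S i) v - pairing g v" for i
    by (simp add: pairing_def sum_subtractf)
  moreover have "0 \<le> vec_norm N v"
    by (simp add: vec_norm_def)
  ultimately show "\<forall>\<^sub>F i in sequentially. norm (pairing (S i) v - pairing g v)
      \<le> norm (vec_dual_norm F N (S i - g) * vec_norm N v)"
    by (auto intro!: always_eventually order_trans[OF _ abs_ge_self])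
  show "(\<lambda>i. vec_dual_norm F N (S i - g) * vec_norm N v) \<longlonglongrightarrow> 0"
    using tendsto_mult_right[OF lim] by simp
qed

end

text \<open>Convolution evaluates \<open>u\<close> at a modified test function, so pointwise
  operations on \<open>u\<close> pass through it.\<close>

lemma grad_heat_add: "grad_heat t (u + v) = grad_heat t u + grad_heat t v"
  by (simp add: grad_heat_def conv_distr_def vec_eq_iff fun_eq_iff)

lemma grad_heat_smul: "grad_heat t (smul c u) = (\<chi> j. smul c (grad_heat t u $ j))"
  by (simp add: grad_heat_def conv_distr_def smul_def vec_eq_iff fun_eq_iff)

section \<open>Measurability and integration\<close>

text \<open>Extension by zero moves the question to the whole space, where completeness of Lebesgue
  measure absorbs the exceptional null set.\<close>

lemma borel_measurable_lebesgue_on_AE_limit: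
  fixes f :: "nat \<Rightarrow> 'a::euclidean_space \<Rightarrow> 'b::euclidean_space"
  assumes A: "A \<in> sets lebesgue"
    and f: "\<And>i. f i \<in> borel_measurable (lebesgue_on A)"
    and lim: "AE x in lebesgue_on A. (\<lambda>i. f i x) \<longlonglongrightarrow> g x"
  shows "g \<in> borel_measurable (lebesgue_on A)"
proof -
  let ?f = "\<lambda>i x. if x \<in> A then f i x else 0" and ?g = "\<lambda>x. if x \<in> A then g x else 0"
  have "?f i \<in> borel_measurable lebesgue" for i
    using f[of i] A by (simp add: borel_measurable_if)
  \<comment> \<open>\<open>lim\<close> has a value at every point, and this function is measurable
    even though the sequence may diverge somewhere.\<close>
  then have "(\<lambda>x. lim (\<lambda>i. ?f i x)) \<in> borel_measurable lebesgue"
    by (rule borel_measurable_lim_metric)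
  moreover have "AE x in lebesgue. lim (\<lambda>i. ?f i x) = ?g x"
    using lim A by (auto simp: AE_restrict_space_iff limI elim!: eventually_mono)
  ultimately have "?g \<in> borel_measurable lebesgue"
    by (rule borel_measurable_AE)
  with A show ?thesis by (simp add: borel_measurable_if)
qed

text \<open>On each of the finitely many level sets of \<open>S\<close> the parameter of
  \<open>P\<close> is constant. This carries weak measurability from a fixed functional to one that
  varies with the point.\<close>

lemma borel_measurable_simple_function_apply:
  fixes P :: "'b \<Rightarrow> 'a \<Rightarrow> 'c::{real_normed_vector, second_countable_topology}"
  assumes S: "simple_function M S"
    and P: "\<And>x. x \<in> space M \<Longrightarrow> P (S x) \<in> borel_measurable M"
  shows "(\<lambda>x. P (S x) x) \<in> borel_measurable M"
proof -
  have fin: "finite (S ` space M)"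
    using S by (rule simple_functionD)
  have "(\<lambda>x. \<Sum>y\<in>S ` space M. indicator (S -` {y} \<inter> space M) x *\<^sub>R P y x) \<in> borel_measurable M"
    using P simple_functionD(2)[OF S] by (intro borel_measurable_sum borel_measurable_scaleR
        borel_measurable_indicator) auto
  moreover have "(\<Sum>y\<in>S ` space M. indicator (S -` {y} \<inter> space M) x *\<^sub>R P y x) = P (S x) x"
    if "x \<in> space M" for x
  proof -
    have "(\<Sum>y\<in>S ` space M. indicator (S -` {y} \<inter> space M) x *\<^sub>R P y x)
        = (\<Sum>y\<in>S ` space M. if y = S x then P y x else 0)"
      using that by (intro sum.cong) (auto simp: indicator_def)
    with that fin show ?thesis by simp
  qed
  ultimately show ?thesis
    by (simp cong: measurable_cong)
qed

text \<open>
  The bounding function \<open>w\<close> need not be measurable: \<open>nn_integral\<close> is then a lower integral, which is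
  still monotone but no longer commutes with scalars through the usual lemma.
\<close>

lemma nn_integral_norm_le_cmult:
  fixes p :: "'a \<Rightarrow> 'b::{real_normed_vector, second_countable_topology}"
  assumes p: "p \<in> borel_measurable M" and m: "0 \<le> m"
    and le: "AE x in M. norm (p x) \<le> m * w x"
    and w: "(\<integral>\<^sup>+ x. ennreal (w x) \<partial>M) \<le> ennreal B"
  shows "(\<integral>\<^sup>+ x. ennreal (norm (p x)) \<partial>M) \<le> ennreal (m * B)"
proof (cases "m = 0")
  case True
  with le have "AE x in M. ennreal (norm (p x)) \<le> 0"
    by simp
  from nn_integral_mono_AE[OF this] True show ?thesis by simp
next
  case False
  with m have m: "0 < m" by simp
  \<comment> \<open>The factor \<open>m\<close> is pulled out on the measurable side;
    \<open>w\<close> enters through monotonicity alone.\<close>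
  have "(\<integral>\<^sup>+ x. ennreal (norm (p x)) \<partial>M) = (\<integral>\<^sup>+ x. ennreal m * ennreal (norm (p x) / m) \<partial>M)"
    using m by (simp add: ennreal_mult[symmetric])
  also have "\<dots> = ennreal m * (\<integral>\<^sup>+ x. ennreal (norm (p x) / m) \<partial>M)"
    using p by (intro nn_integral_cmult) simp
  also have "(\<integral>\<^sup>+ x. ennreal (norm (p x) / m) \<partial>M) \<le> (\<integral>\<^sup>+ x. ennreal (w x) \<partial>M)"
    using le m by (intro nn_integral_mono_AE) (auto simp: field_simps intro!: ennreal_leI elim!: eventually_mono)
  also note w
  finally show ?thesis
    using m by (simp add: ennreal_mult' mult_left_mono)
qed

section \<open>Essential bounds on the half-line\<close>

lemma emeasure_half_line: "emeasure half_line (space half_line) \<noteq> 0"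
proof
  assume "emeasure half_line (space half_line) = 0"
  then have "emeasure lebesgue {0::real<..} = 0"
    by (simp add: emeasure_restrict_space)
  moreover have "emeasure lebesgue {0::real<..<1} \<le> emeasure lebesgue {0::real<..}"
    by (rule emeasure_mono) auto
  ultimately show False by simp
qed

text \<open>As \<open>vec_dual_norm\<close> is nonnegative, a negative essential supremum would make
  a falsehood hold almost everywhere, impossible on a space of nonzero measure. Together with
  finiteness this leaves a real number.\<close>

lemma Linf_dualE:
  assumes f: "f \<in> Linf_dual F N"
  obtains m where "0 \<le> m" "Linf_norm F N f = ereal m"
    "AE s in half_line. vec_dual_norm F N (f s) \<le> m"
proof -
  have AE: "AE s in half_line. ereal (vec_dual_norm F N (f s)) \<le> Linf_norm F N f"
    unfolding Linf_norm_def by (rule esssup_AE)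
  have "0 \<le> Linf_norm F N f"
  proof (rule ccontr)
    assume neg: "\<not> 0 \<le> Linf_norm F N f"
    have "AE s in half_line. False"
      using AE
    proof eventually_elim
      case (elim s)
      moreover have "0 \<le> ereal (vec_dual_norm F N (f s))"
        by (simp add: vec_dual_norm_def)
      ultimately show ?case using neg order_trans by blast
    qed
    then show False
      using emeasure_half_line by (simp add: trivial_limit_def[symmetric] ae_filter_eq_bot_iff)
  qed
  moreover have "Linf_norm F N f < \<infinity>"
    using f by (simp add: Linf_dual_def)
  ultimately obtain m where "0 \<le> m" "Linf_norm F N f = ereal m"
    by (cases "Linf_norm F N f") auto
  with AE show ?thesis by (auto intro: that)
qed

section \<open>The estimate for the functional \<open>T_op E f\<close>\<close>

theorem lemma3p3:
  fixes E E0 :: "('k::{real_normed_field, euclidean_space}, 'n::finite) distr set"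
    and NE NE0 :: "('k, 'n) distr \<Rightarrow> real"
    and \<sigma>E \<sigma>E0 :: real
  assumes dim: "CARD('n) \<ge> 3"
    and E: "class_G E NE \<sigma>E"
    and E0: "class_G E0 NE0 \<sigma>E0"
    and exponents: "\<sigma>E0 - \<sigma>E - 1 = 0"
    and bounded: "\<And>t. t > 0 \<Longrightarrow> \<exists>K. \<forall>h\<in>E. grad_heat t h \<in> vec_space E0 \<and>
           vec_norm NE0 (grad_heat t h) \<le> K * NE h"
    and weakly_measurable: "\<And>h g. h \<in> E \<Longrightarrow> g \<in> vec_dual E0 NE0 \<Longrightarrow>
           (\<lambda>s. pairing g (grad_heat s h)) \<in> borel_measurable half_line"
    and integral_bound: "\<exists>C>0. \<forall>h\<in>E.
           (\<integral>\<^sup>+ s. ennreal (s powr ((\<sigma>E0 - \<sigma>E) / 2 - 1 / 2) * vec_norm NE0 (grad_heat s h)) \<partial>half_line)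
             \<le> ennreal (C * NE h)"
  shows "\<exists>C>0. \<forall>f\<in>Linf_dual E0 NE0.
           (\<forall>h\<in>E. integrable half_line (\<lambda>s. grad_heat_dual E s (f s) h)) \<and>
           T_op E f \<in> dual E NE \<and>
           ereal (dual_norm E NE (T_op E f)) \<le> ereal C * Linf_norm E0 NE0 f"
proof -
  have BE: "banach_in_tempered E NE" and BE0: "banach_in_tempered E0 NE0"
    using E E0 by (auto simp: class_G_def)
  have grad_mem: "grad_heat s h \<in> vec_space E0" if "s > 0" "h \<in> E" for s h
    using bounded[OF that(1)] that(2) by blast
  \<comment> \<open>The exponent is 1/2 - 1/2 = 0; positivity of \<open>s\<close> matters because
    \<open>0 powr 0\<close> is 0.\<close>
  have weight: "s powr ((\<sigma>E0 - \<sigma>E) / 2 - 1 / 2) = 1" if "s > 0" for s :: real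
    using exponents that by (simp add: diff_divide_distrib[symmetric])
  obtain C where "C > 0" and C: "\<And>h. h \<in> E \<Longrightarrow>
      (\<integral>\<^sup>+ s. ennreal (s powr ((\<sigma>E0 - \<sigma>E) / 2 - 1 / 2) * vec_norm NE0 (grad_heat s h)) \<partial>half_line)
        \<le> ennreal (C * NE h)"
    using integral_bound by blast
  have C: "(\<integral>\<^sup>+ s. ennreal (vec_norm NE0 (grad_heat s h)) \<partial>half_line) \<le> ennreal (C * NE h)"
    if "h \<in> E" for h
  proof -
    have "(\<integral>\<^sup>+ s. ennreal (s powr ((\<sigma>E0 - \<sigma>E) / 2 - 1 / 2) * vec_norm NE0 (grad_heat s h)) \<partial>half_line)
        = (\<integral>\<^sup>+ s. ennreal (vec_norm NE0 (grad_heat s h)) \<partial>half_line)"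
      by (intro nn_integral_cong) (simp add: weight)
    with C[OF that] show ?thesis by (simp only:)
  qed
  \<comment> \<open>The \<open>C\<close> of the integral hypothesis serves for every
    \<open>f\<close>; the dependence on \<open>f\<close> sits in its essential supremum
    \<open>m\<close>.\<close>
  have "(\<forall>h\<in>E. integrable half_line (\<lambda>s. grad_heat_dual E s (f s) h)) \<and>
      T_op E f \<in> dual E NE \<and>
      ereal (dual_norm E NE (T_op E f)) \<le> ereal C * Linf_norm E0 NE0 f"
    if f: "f \<in> Linf_dual E0 NE0" for f
  proof -
    let ?p = "\<lambda>h s. grad_heat_dual E s (f s) h"
    obtain m where m: "0 \<le> m" "Linf_norm E0 NE0 f = ereal m"
      and f_le: "AE s in half_line. vec_dual_norm E0 NE0 (f s) \<le> m"
      using f by (rule Linf_dualE)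
    have f_mem: "f s \<in> vec_dual E0 NE0" if "s > 0" for s
      using f that by (simp add: Linf_dual_def)
    obtain S where S: "\<And>i. simple_function half_line (S i)"
      and S_mem: "\<And>i s. s > 0 \<Longrightarrow> S i s \<in> vec_dual E0 NE0"
      and S_lim: "AE s in half_line. (\<lambda>i. vec_dual_norm E0 NE0 (S i s - f s)) \<longlonglongrightarrow> 0"
      using f by (auto simp: Linf_dual_def strongly_measurable_def)
    have p_measurable: "?p h \<in> borel_measurable half_line" if h: "h \<in> E" for h
    proof -
      \<comment> \<open>Weak measurability handles each of the finitely many values of
        \<open>S i\<close>; the pairings with \<open>S i s\<close> converge for almost every
        \<open>s\<close>.\<close>
      have "(\<lambda>s. pairing (f s) (grad_heat s h)) \<in> borel_measurable half_line"
      proof (rule borel_measurable_lebesgue_on_AE_limit)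
        show "(\<lambda>s. pairing (S i s) (grad_heat s h)) \<in> borel_measurable half_line" for i
          using S[of i]
          by (rule borel_measurable_simple_function_apply[where P = "\<lambda>g s. pairing g (grad_heat s h)"])
            (simp add: weakly_measurable h S_mem)
        show "AE s in half_line. (\<lambda>i. pairing (S i s) (grad_heat s h))
            \<longlonglongrightarrow> pairing (f s) (grad_heat s h)"
          using S_lim AE_space
          by eventually_elim
            (auto intro!: tendsto_pairing[OF BE0] S_mem f_mem grad_mem h)
      qed simp
      with h show ?thesis by (simp add: grad_heat_dual_def)
    qed
    have p_le: "AE s in half_line. norm (?p h s) \<le> m * vec_norm NE0 (grad_heat s h)"
      if h: "h \<in> E" for h
      using f_le AE_space
    proof eventually_elim
      case (elim s)
      then have s: "s > 0" by simp
      have "norm (?p h s) \<le> vec_dual_norm E0 NE0 (f s) * vec_norm NE0 (grad_heat s h)"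
        using norm_pairing_le[OF BE0 f_mem[OF s] grad_mem[OF s h]] h by (simp add: grad_heat_dual_def)
      also have "\<dots> \<le> m * vec_norm NE0 (grad_heat s h)"
        using elim(1) by (intro mult_right_mono) (simp_all add: vec_norm_def)
      finally show ?case .
    qed
    \<comment> \<open>Measurability of \<open>vec_norm NE0 (grad_heat s h)\<close> in
      \<open>s\<close> is not assumed, so the bound goes through the lower integral.\<close>
    have p_int: "(\<integral>\<^sup>+ s. ennreal (norm (?p h s)) \<partial>half_line) \<le> ennreal (m * (C * NE h))"
      if "h \<in> E" for h
      using p_measurable[OF that] m(1) p_le[OF that] C[OF that] by (rule nn_integral_norm_le_cmult)
    have p_integrable: "integrable half_line (?p h)" if "h \<in> E" for h
      using p_measurable[OF that] le_less_trans[OF p_int[OF that] ennreal_less_top]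
      by (intro integrableI_bounded) simp_all
    have T_bound: "norm (T_op E f h) \<le> m * C * NE h" if h: "h \<in> E" for h
    proof -
      have "ennreal (norm (LINT s|half_line. ?p h s)) \<le> ennreal (m * (C * NE h))"
        using integral_norm_bound_ennreal[OF p_integrable[OF h]] p_int[OF h] by (rule order_trans)
      \<comment> \<open>Needed to strip \<open>ennreal\<close>, which sends negative reals to
        0.\<close>
      moreover have "0 \<le> m * (C * NE h)"
        using m(1) \<open>C > 0\<close> norm_distr_nonneg[OF BE h] by simp
      ultimately show ?thesis
        using h by (simp add: T_op_def mult.assoc)
    qed
    have T_add: "T_op E f (u + v) = T_op E f u + T_op E f v" if u: "u \<in> E" and v: "v \<in> E" for u v
    proof -
      \<comment> \<open>The integrands agree at every \<open>s > 0\<close>, where the memberships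
        hold; integrability of both summands then splits the integral.\<close>
      have "(LINT s|half_line. ?p (u + v) s) = (LINT s|half_line. ?p u s + ?p v s)"
        using u v add_mem[OF BE u v]
        by (intro Bochner_Integration.integral_cong)
          (simp_all add: grad_heat_dual_def grad_heat_add pairing_add_right[OF BE0] f_mem grad_mem)
      then show ?thesis
        using u v add_mem[OF BE u v] by (simp add: T_op_def p_integrable)
    qed
    have T_smul: "T_op E f (smul c u) = c * T_op E f u" if u: "u \<in> E" for c u
    proof -
      have "(LINT s|half_line. ?p (smul c u) s) = (LINT s|half_line. c * ?p u s)"
        using u smul_mem[OF BE u]
        by (intro Bochner_Integration.integral_cong)
          (simp_all add: grad_heat_dual_def grad_heat_smul pairing_smul_right[OF BE0] f_mem grad_mem)
      then show ?thesis
        using u smul_mem[OF BE u] by (simp add: T_op_def p_integrable)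
    qed
    have T_outside: "T_op E f u = 0" if "u \<notin> E" for u
      using that by (simp add: T_op_def)
    have "T_op E f \<in> dual E NE"
      using T_bound T_add T_smul T_outside unfolding dual_def by blast
    moreover have "dual_norm E NE (T_op E f) \<le> m * C"
      unfolding dual_norm_def
    proof (rule cSUP_least)
      show "{u \<in> E. NE u \<le> 1} \<noteq> {}"
        using zero_mem[OF BE] norm_zero_distr[OF BE] by auto
      fix u assume u: "u \<in> {u \<in> E. NE u \<le> 1}"
      then have "m * C * NE u \<le> m * C * 1"
        using m(1) \<open>C > 0\<close> by (intro mult_left_mono) auto
      with T_bound[of u] u show "norm (T_op E f u) \<le> m * C" by simp
    qed
    ultimately show ?thesis
      using p_integrable m(2) by (simp add: mult.commute)
  qed
  with \<open>C > 0\<close> show ?thesis by blast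
qed

end
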